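(* For any matroid $\mathsf{M}$ on a finite nonempty set $E$, $$Q_{\mathsf{M}}(1)=\prod_{\substack{i\in E\\ i\text{ is a loop of }\mathsf{M}}}(1-x_i),$$ where $1$ denotes the constant piecewise Laurent polynomial ($f_\sigma=1$ for all $\sigma\in S_E$).
   Context: Let $|E|=n$; $S_E$ is the set of bijections $\sigma:[n]\to E$, $[n]=\{1,\dots,n\}$. For a matroid $\mathsf{M}$ on $E$ with rank function $\mathrm{rk}_{\mathsf{M}}$, the greedy basis is $B_{\mathsf{M}}(\sigma)=\{\sigma(i):\mathrm{rk}_{\mathsf{M}}\{\sigma(1),\dots,\sigma(i)\}>\mathrm{rk}_{\mathsf{M}}\{\sigma(1),\dots,\sigma(i-1)\}\}$. For a collection $f=\{f_\sigma:\sigma\in S_E\}$ of Laurent polynomials in $\mathbb{Z}[x_e^{\pm1}:e\in E]$, $$Q_{\mathsf{M}}(f)=\sum_{\sigma\in S_E}f_\sigma\,\frac{1}{\prod_{i=1}^{n-1}\left(1-\frac{x_{\sigma(i+1)}}{x_{\sigma(i)}}\right)}\prod_{i\in E\setminus B_{\mathsf{M}}(\sigma)}(1-x_i)\in\mathbb{Z}(x_e:e\in E).$$ A loop of $\mathsf{M}$ is an element contained in no basis. *)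

theory Defs
  imports
    "HOL-Library.Poly_Mapping"
    "HOL-Library.FuncSet"
    "HOL-Computational_Algebra.Fraction_Field"
begin

section \<open>Laurent polynomials and rational functions\<close>

text \<open>
  The Laurent polynomial ring \<open>\<int>[x\<^sub>e\<^sup>\<plusminus>\<^sup>1]\<close>: finitely supported integer-valued functions on the
  exponent vectors \<open>'a \<Rightarrow>\<^sub>0 int\<close>, with the convolution product of \<^theory>\<open>HOL-Library.Poly_Mapping\<close>.
  A copy of that type is used because the library instance of \<^class>\<open>idom\<close> needs a linear order on
  the exponents, hence on the variables; here the index type \<open>'a\<close> of the variables is arbitrary.
\<close>

typedef 'a laurent = "UNIV :: (('a \<Rightarrow>\<^sub>0 int) \<Rightarrow>\<^sub>0 int) set"
  morphisms laurent_coeffs Laurent by simp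

setup_lifting type_definition_laurent

instantiation laurent :: (type) comm_ring_1
begin

lift_definition zero_laurent :: "'a laurent" is 0 .
lift_definition one_laurent :: "'a laurent" is 1 .
lift_definition plus_laurent :: "'a laurent \<Rightarrow> 'a laurent \<Rightarrow> 'a laurent" is "(+)" .
lift_definition minus_laurent :: "'a laurent \<Rightarrow> 'a laurent \<Rightarrow> 'a laurent" is "(-)" .
lift_definition uminus_laurent :: "'a laurent \<Rightarrow> 'a laurent" is uminus .
lift_definition times_laurent :: "'a laurent \<Rightarrow> 'a laurent \<Rightarrow> 'a laurent" is "(*)" .

instance
  by standard (transfer; simp add: algebra_simps)+

end

context
begin

private abbreviation (input) "lk \<equiv> Poly_Mapping.lookup"
private abbreviation (input) "ks \<equiv> Poly_Mapping.keys"

text \<open>Two finite sets of exponent vectors have a sum that is attained only once.\<close>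

lemma unique_sum_aux:
  fixes A B :: "('a \<Rightarrow>\<^sub>0 int) set"
  assumes "finite V" "finite A" "finite B" "A \<noteq> {}" "B \<noteq> {}"
    and "\<And>a a' v. a \<in> A \<Longrightarrow> a' \<in> A \<Longrightarrow> v \<notin> V \<Longrightarrow> lk a v = lk a' v"
    and "\<And>b b' v. b \<in> B \<Longrightarrow> b' \<in> B \<Longrightarrow> v \<notin> V \<Longrightarrow> lk b v = lk b' v"
  shows "\<exists>a\<in>A. \<exists>b\<in>B. \<forall>a'\<in>A. \<forall>b'\<in>B. a' + b' = a + b \<longrightarrow> a' = a \<and> b' = b"
  using assms
proof (induction V arbitrary: A B rule: finite_induct)
  case empty
  obtain a b where ab: "a \<in> A" "b \<in> B" using empty by blast
  have "\<forall>a'\<in>A. a' = a" "\<forall>b'\<in>B. b' = b"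
    using empty.prems(5)[OF _ ab(1)] empty.prems(6)[OF _ ab(2)]
    by (simp_all add: poly_mapping_eqI)
  with ab show ?case by blast
next
  case (insert v V)
  define m where "m = Max ((\<lambda>a. lk a v) ` A)"
  define n where "n = Max ((\<lambda>b. lk b v) ` B)"
  define A' where "A' = {a \<in> A. lk a v = m}"
  define B' where "B' = {b \<in> B. lk b v = n}"
  have m: "lk a v \<le> m" if "a \<in> A" for a
    unfolding m_def using insert.prems that by auto
  have n: "lk b v \<le> n" if "b \<in> B" for b
    unfolding n_def using insert.prems that by auto
  have "m \<in> (\<lambda>a. lk a v) ` A" "n \<in> (\<lambda>b. lk b v) ` B"
    unfolding m_def n_def using insert.prems by (auto intro!: Max_in)
  then have ne: "A' \<noteq> {}" "B' \<noteq> {}" unfolding A'_def B'_def by auto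
  have fin: "finite A'" "finite B'" unfolding A'_def B'_def using insert.prems by auto
  have agA: "lk a w = lk a' w" if "a \<in> A'" "a' \<in> A'" "w \<notin> V" for a a' w
    using that insert.prems(5)[of a a' w] unfolding A'_def by (cases "w = v") auto
  have agB: "lk b w = lk b' w" if "b \<in> B'" "b' \<in> B'" "w \<notin> V" for b b' w
    using that insert.prems(6)[of b b' w] unfolding B'_def by (cases "w = v") auto
  obtain a b where ab: "a \<in> A'" "b \<in> B'"
    and uniq: "\<And>a' b'. a' \<in> A' \<Longrightarrow> b' \<in> B' \<Longrightarrow> a' + b' = a + b \<Longrightarrow> a' = a \<and> b' = b"
    using insert.IH[OF fin ne agA agB] by blast
  have "a' = a \<and> b' = b" if "a' \<in> A" "b' \<in> B" "a' + b' = a + b" for a' b'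
  proof -
    have "lk a' v + lk b' v = m + n"
      using arg_cong[OF that(3), of "\<lambda>p. lk p v"] ab
      by (simp add: lookup_add A'_def B'_def)
    with m[OF that(1)] n[OF that(2)] have "lk a' v = m" "lk b' v = n" by linarith+
    with that uniq show ?thesis unfolding A'_def B'_def by blast
  qed
  moreover have "a \<in> A" "b \<in> B" using ab unfolding A'_def B'_def by auto
  ultimately show ?case by blast
qed

lemma poly_mapping_no_zero_divisors:
  fixes p q :: "('a \<Rightarrow>\<^sub>0 int) \<Rightarrow>\<^sub>0 int"
  assumes "p \<noteq> 0" "q \<noteq> 0"
  shows "p * q \<noteq> 0"
proof -
  define V where "V = (\<Union>k\<in>ks p \<union> ks q. ks k)"
  have zero: "lk k v = 0" if "k \<in> ks p \<union> ks q" "v \<notin> V" for k v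
    using that unfolding V_def by (auto simp: in_keys_iff)
  have "\<exists>a\<in>ks p. \<exists>b\<in>ks q. \<forall>a'\<in>ks p. \<forall>b'\<in>ks q. a' + b' = a + b \<longrightarrow> a' = a \<and> b' = b"
    by (rule unique_sum_aux[of V]) (use assms zero in \<open>auto simp: V_def\<close>)
  then obtain a b where ab: "a \<in> ks p" "b \<in> ks q"
    and uniq: "\<And>a' b'. a' \<in> ks p \<Longrightarrow> b' \<in> ks q \<Longrightarrow> a' + b' = a + b \<Longrightarrow> a' = a \<and> b' = b"
    by blast
  have inner: "lk p l * (\<Sum>r. lk q r when a + b = l + r)
      = (lk p a * lk q b when l = a)" for l
  proof (cases "l \<in> ks p")
    case False
    then show ?thesis using ab by (auto simp: in_keys_iff when_def)
  next
    case True
    have "(lk q r when a + b = l + r) = (lk q b when l = a when r = b)" for r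
      using uniq[OF True, of r] by (cases "lk q r = 0") (auto simp: when_def in_keys_iff)
    then have "(\<Sum>r. lk q r when a + b = l + r) = (lk q b when l = a)"
      by simp
    then show ?thesis by (simp add: when_def)
  qed
  have "lk (p * q) (a + b) = lk p a * lk q b"
    by (simp add: lookup_mult inner)
  also have "\<dots> \<noteq> 0" using ab by (simp add: in_keys_iff)
  finally show ?thesis by auto
qed

end

instance laurent :: (type) idom
  by standard (transfer, rule poly_mapping_no_zero_divisors)

lift_definition laurent_var :: "'a \<Rightarrow> 'a laurent" is
  "\<lambda>e. Poly_Mapping.single (Poly_Mapping.single e 1) 1" .

text \<open>
  The fraction field of the Laurent polynomial ring is the fraction field of the polynomial ring,
  i.e. the field of rational functions \<open>\<int>(x\<^sub>e)\<close>.  The variables are indexed by all of \<open>'a\<close>; for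
  \<open>E \<subseteq> 'a\<close> the field \<open>\<int>(x\<^sub>e : e \<in> E)\<close> is the subfield generated by the \<open>x\<^sub>e\<close> with \<open>e \<in> E\<close>.
\<close>

type_synonym 'a ratfun = "'a laurent fract"

definition of_laurent :: "'a laurent \<Rightarrow> 'a ratfun" where
  "of_laurent p = Fract p 1"

definition X :: "'a \<Rightarrow> 'a ratfun" where
  "X e = of_laurent (laurent_var e)"

section \<open>Matroids\<close>

locale matroid =
  fixes E :: "'a set" and indep :: "'a set \<Rightarrow> bool"
  assumes finite_ground: "finite E"
    and indep_subset_ground: "indep I \<Longrightarrow> I \<subseteq> E"
    and indep_empty: "indep {}"
    and indep_subset: "indep I \<Longrightarrow> J \<subseteq> I \<Longrightarrow> indep J"
    and indep_augment: "indep I \<Longrightarrow> indep J \<Longrightarrow> card I < card J \<Longrightarrow> \<exists>e\<in>J - I. indep (insert e I)"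
begin

definition rk :: "'a set \<Rightarrow> nat" where
  "rk S = Max {card I |I. I \<subseteq> S \<and> indep I}"

definition basis :: "'a set \<Rightarrow> bool" where
  "basis B \<longleftrightarrow> indep B \<and> (\<forall>I. indep I \<longrightarrow> B \<subseteq> I \<longrightarrow> I = B)"

definition loop :: "'a \<Rightarrow> bool" where
  "loop e \<longleftrightarrow> e \<in> E \<and> \<not> (\<exists>B. basis B \<and> e \<in> B)"

text \<open>Extensionality makes each bijection \<open>{1..n} \<rightarrow> E\<close> appear exactly once.\<close>

definition orderings :: "(nat \<Rightarrow> 'a) set" where
  "orderings = {\<sigma> \<in> {1..card E} \<rightarrow>\<^sub>E E. bij_betw \<sigma> {1..card E} E}"

definition greedy_basis :: "(nat \<Rightarrow> 'a) \<Rightarrow> 'a set" where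
  "greedy_basis \<sigma> = {\<sigma> i |i. i \<in> {1..card E} \<and> rk (\<sigma> ` {1..i}) > rk (\<sigma> ` {1..i - 1})}"

definition Q :: "((nat \<Rightarrow> 'a) \<Rightarrow> 'a laurent) \<Rightarrow> 'a ratfun" where
  "Q f = (\<Sum>\<sigma>\<in>orderings. of_laurent (f \<sigma>)
      * (1 / (\<Prod>i = 1..card E - 1. 1 - X (\<sigma> (i + 1)) / X (\<sigma> i)))
      * (\<Prod>i\<in>E - greedy_basis \<sigma>. 1 - X i))"

end

end

theory Submission
  imports Defs "HOL-Combinatorics.Multiset_Permutations"
begin

text \<open>
  Build the orderings of a set by inserting an element \<open>e\<close> into the orderings of the remaining
  elements. The sum of the chain weights over the first positions of \<open>e\<close>, up to just before an
  element \<open>f\<close>, telescopes to \<open>e / (e - f)\<close> times the chain weight without \<open>e\<close>, and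
  over all positions to that weight itself. If \<open>e\<close> is a loop, it is never greedy and contributes
  the factor \<open>1 - e\<close>. If \<open>e\<close> is neither a loop nor a coloop, let \<open>f\<close> be the element
  with which the given ordering first spans \<open>e\<close>: inserting \<open>e\<close> before \<open>f\<close> makes
  \<open>e\<close> greedy and \<open>f\<close> not, and inserting it after \<open>f\<close> changes no other status. The
  two parts add up by \<open>e (1 - f) / (e - f) + f (1 - e) / (f - e) = 1\<close>. Coloops are always greedy
  and contribute the factor \<open>1\<close>.
\<close>

section \<open>Summing over the insertions of an element into a list\<close>

text \<open>As a preimage under \<open>remove1 e\<close>, this is a fibre of the map that deletes
  \<open>e\<close> from an ordering. When \<open>e\<close> does not occur in \<open>l\<close>, it
  consists of all placements of \<open>e\<close> in \<open>l\<close>.\<close>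

definition insertions :: "'a \<Rightarrow> 'a list \<Rightarrow> 'a list set" where
  "insertions e l = {l'. e \<in> set l' \<and> remove1 e l' = l}"

lemma insertions_Nil: "insertions e [] = {[e]}"
proof -
  have "l' = [e]" if "e \<in> set l'" "remove1 e l' = []" for l'
    using that by (cases l') (auto split: if_splits)
  then show ?thesis by (auto simp: insertions_def)
qed

lemma insertions_Cons:
  assumes "e \<noteq> z"
  shows "insertions e (z # l) = insert (e # z # l) ((#) z ` insertions e l)"
proof -
  have "l' = e # z # l \<or> l' \<in> (#) z ` insertions e l"
    if "e \<in> set l'" "remove1 e l' = z # l" for l'
    using that assms by (cases l') (auto simp: insertions_def split: if_splits)
  then show ?thesis using assms by (auto simp: insertions_def)
qed

lemma finite_insertions: "e \<notin> set l \<Longrightarrow> finite (insertions e l)"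
  by (induction l) (auto simp: insertions_Nil insertions_Cons)

lemma sum_insertions_Cons:
  assumes "e \<notin> set (z # l)"
  shows "(\<Sum>l'\<in>insertions e (z # l). f l') = f (e # z # l) + (\<Sum>l'\<in>insertions e l. f (z # l'))"
proof -
  have "(\<Sum>l'\<in>(#) z ` insertions e l. f l') = (\<Sum>l'\<in>insertions e l. f (z # l'))"
    by (subst sum.reindex) auto
  then show ?thesis
    using assms by (subst insertions_Cons, force, subst sum.insert) (auto simp: finite_insertions)
qed

text \<open>Group the orderings of \<open>insert e A\<close> by what remains after deleting
  \<open>e\<close>; the fibre over \<open>l\<close> is \<open>insertions e l\<close>.\<close>

lemma sum_permutations_of_set_insert:
  assumes "finite A" "e \<notin> A"
  shows "(\<Sum>l\<in>permutations_of_set (insert e A). f l)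
    = (\<Sum>l\<in>permutations_of_set A. \<Sum>l'\<in>insertions e l. f l')"
proof -
  let ?P = "permutations_of_set (insert e A)"
  have mem: "l' \<in> ?P" if "l \<in> permutations_of_set A" "l' \<in> insertions e l" for l l'
  proof -
    have e: "e \<in> set l'" "remove1 e l' = l" using that by (auto simp: insertions_def)
    have l: "set l = A" "distinct l" using that by (auto simp: permutations_of_set_def)
    obtain ys zs where l': "l' = ys @ e # zs" "e \<notin> set ys"
      using split_list_first[OF e(1)] by blast
    with e(2) have "l = ys @ zs" by (simp add: remove1_append)
    with l l' assms(2) show ?thesis by (auto simp: permutations_of_set_def)
  qed
  have "(\<Sum>l\<in>?P. f l)
      = (\<Sum>l\<in>permutations_of_set A. \<Sum>l'\<in>{l' \<in> ?P. remove1 e l' = l}. f l')"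
  proof (rule sum.group[symmetric])
    show "remove1 e ` ?P \<subseteq> permutations_of_set A"
      using assms by (auto simp: permutations_of_set_def)
  qed (rule finite_permutations_of_set)+
  also have "\<dots> = (\<Sum>l\<in>permutations_of_set A. \<Sum>l'\<in>insertions e l. f l')"
  proof (intro sum.cong refl)
    fix l assume l: "l \<in> permutations_of_set A"
    have "e \<in> set l'" if "l' \<in> ?P" for l'
      using permutations_of_setD(1)[OF that] by simp
    with mem[OF l] show "{l' \<in> ?P. remove1 e l' = l} = insertions e l"
      by (fastforce simp: insertions_def)
  qed
  finally show ?thesis .
qed

text \<open>
  The parameter \<open>u\<close> is the inverse of the variable preceding the list, and \<open>u = 0\<close> encodes
  that nothing precedes it.
\<close>

fun chain_weight :: "('a \<Rightarrow> 'b::field) \<Rightarrow> 'b \<Rightarrow> 'a list \<Rightarrow> 'b" where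
  "chain_weight x u [] = 1"
| "chain_weight x u (a # l) = 1 / (1 - u * x a) * chain_weight x (1 / x a) l"

lemma chain_weight_Cons:
  "chain_weight x u (a # l) = 1 / (1 - u * x a)
     * (1 / (\<Prod>i<length l. 1 - x ((a # l) ! Suc i) / x ((a # l) ! i)))"
proof (induction l arbitrary: u a)
  case (Cons b l)
  show ?case
    unfolding chain_weight.simps(2)[of x u a] Cons.IH
    by (simp add: prod.lessThan_Suc_shift del: prod.lessThan_Suc)
qed simp

lemma chain_weight_0:
  "chain_weight x 0 l = 1 / (\<Prod>i<length l - 1. 1 - x (l ! Suc i) / x (l ! i))"
  by (cases l) (simp_all add: chain_weight_Cons del: chain_weight.simps(2))

text \<open>Here \<open>r\<close> is the link factor for \<open>y\<close> directly before
  \<open>z\<close>, and \<open>s\<close> the one for the reverse order. These relations are all that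
  the later calculations need to know about the two quotients.\<close>

lemma chain_factor_identities:
  fixes y z :: "'b::field"
  assumes "y \<noteq> z" "y \<noteq> 0" "z \<noteq> 0"
  defines "r \<equiv> 1 / (1 - z / y)" and "s \<equiv> 1 / (1 - y / z)"
  shows "r + s = 1" "r * (y - z) = y" "r * z + s * y = 0" "y / z * s = - r"
proof -
  define d where "d = y - z"
  have y: "y = z + d" "d \<noteq> 0" using assms by (auto simp: d_def)
  have "r = y / d" "1 - y / z = - (d / z)" using assms by (simp_all add: divide_simps d_def)
  then show "r + s = 1" "r * (y - z) = y" "r * z + s * y = 0" "y / z * s = - r"
    unfolding s_def using y assms(2,3)
    by (auto simp: d_def[symmetric]) (auto simp: field_simps y(1))
qed

lemma sum_chain_weight_insertions:
  fixes x :: "'a \<Rightarrow> 'b::field"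
  assumes "inj x" "\<And>a. x a \<noteq> 0" "distinct (e # l)" "\<And>a. a \<in> set (e # l) \<Longrightarrow> u * x a \<noteq> 1"
  shows "(\<Sum>l'\<in>insertions e l. chain_weight x u l') = chain_weight x u l / (1 - u * x e)"
  using assms(3,4)
proof (induction l arbitrary: u)
  case Nil
  then show ?case by (simp add: insertions_Nil)
next
  case (Cons z l)
  define p where "p = 1 / (1 - u * x e)"
  define q where "q = 1 / (1 - u * x z)"
  define r where "r = 1 / (1 - x z / x e)"
  define s where "s = 1 / (1 - x e / x z)"
  define k where "k = chain_weight x (1 / x z) l"
  \<comment> \<open>Once \<open>z\<close> is read, the parameter is \<open>1 / x z\<close>;
    injectivity of \<open>x\<close> keeps the remaining denominators nonzero.\<close>
  have "1 / x z * x a \<noteq> 1" if "a \<in> set (e # l)" for a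
    using Cons.prems(1) that injD[OF assms(1), of a z] assms(2) by (auto simp: field_simps)
  then have IH: "(\<Sum>l'\<in>insertions e l. chain_weight x (1 / x z) l') = k * s"
    using Cons.IH[of "1 / x z"] Cons.prems(1) by (simp add: k_def s_def)
  have "(\<Sum>l'\<in>insertions e l. chain_weight x u (z # l')) = q * (k * s)"
    unfolding chain_weight.simps sum_distrib_left[symmetric] IH q_def ..
  then have "(\<Sum>l'\<in>insertions e (z # l). chain_weight x u l') = p * (r * k) + q * (k * s)"
    using Cons.prems(1) by (subst sum_insertions_Cons) (simp_all add: p_def r_def k_def)
  \<comment> \<open>Dividing by \<open>p * q * k\<close> leaves
    \<open>r * (1 - u * x z) + s * (1 - u * x e) = 1\<close>, which follows from
    \<open>r + s = 1\<close> and \<open>r * x z + s * x e = 0\<close>.\<close>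
  also have "\<dots> = q * k * p"
  proof -
    have "x e \<noteq> x z" using Cons.prems(1) injD[OF assms(1), of e z] by auto
    note chain_factor_identities[OF this assms(2) assms(2), folded r_def s_def]
    moreover have "p * (1 - u * x e) = 1" "q * (1 - u * x z) = 1"
      using Cons.prems(2) by (auto simp: p_def q_def)
    ultimately show ?thesis by algebra
  qed
  finally show ?case by (simp add: p_def q_def k_def)
qed

section \<open>Rank and span\<close>

context matroid
begin

lemma finite_indep: "indep I \<Longrightarrow> finite I"
  using finite_ground indep_subset_ground finite_subset by blast

lemma finite_rk_set: "finite {card I |I. I \<subseteq> S \<and> indep I}"
  by (rule finite_subset[of _ "card ` Pow E"]) (use finite_ground indep_subset_ground in auto)

lemma rk_ge: "I \<subseteq> S \<Longrightarrow> indep I \<Longrightarrow> card I \<le> rk S"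
  unfolding rk_def by (rule Max_ge[OF finite_rk_set]) auto

lemma rk_attained: obtains I where "I \<subseteq> S" "indep I" "card I = rk S"
proof -
  have "rk S \<in> {card I |I. I \<subseteq> S \<and> indep I}"
    unfolding rk_def by (rule Max_in[OF finite_rk_set]) (use indep_empty in auto)
  then show ?thesis using that by auto
qed

lemma rk_mono: "S \<subseteq> T \<Longrightarrow> rk S \<le> rk T"
  by (rule rk_attained[of S]) (metis rk_ge subset_trans)

lemma rk_insert_le: "rk (insert a S) \<le> Suc (rk S)"
proof -
  obtain I where I: "I \<subseteq> insert a S" "indep I" "card I = rk (insert a S)"
    by (rule rk_attained)
  have "card (I - {a}) \<le> rk S" using I indep_subset by (intro rk_ge) auto
  then show ?thesis using I(3) card_Diff1_le[of I a] by (cases "a \<in> I") (auto simp: finite_indep I)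
qed

text \<open>Augment \<open>I\<close> repeatedly from a maximum independent subset of
  \<open>S\<close>, by induction on the missing number of elements.\<close>

lemma indep_extend:
  assumes "I \<subseteq> S" "indep I"
  obtains J where "I \<subseteq> J" "J \<subseteq> S" "indep J" "card J = rk S"
proof -
  have "\<exists>J. I \<subseteq> J \<and> J \<subseteq> S \<and> indep J \<and> card J = rk S"
    using assms
  proof (induction "rk S - card I" arbitrary: I)
    case 0
    then show ?case using rk_ge[of I S] by force
  next
    case (Suc n)
    obtain K where K: "K \<subseteq> S" "indep K" "card K = rk S" by (rule rk_attained)
    then obtain e where e: "e \<in> K - I" "indep (insert e I)"
      using Suc.hyps(2) Suc.prems indep_augment[of I K] by force
    have "n = rk S - card (insert e I)" using Suc.hyps(2) e Suc.prems(2) by (auto simp: finite_indep)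
    then have "\<exists>J. insert e I \<subseteq> J \<and> J \<subseteq> S \<and> indep J \<and> card J = rk S"
      using Suc.prems e K(1) by (intro Suc.hyps(1)) auto
    then show ?case by blast
  qed
  then show ?thesis using that by blast
qed

text \<open>Membership in the matroid closure of \<open>S\<close>, in terms of rank so that an
  element fails to be greedy exactly when its predecessors span it.\<close>

definition spans :: "'a set \<Rightarrow> 'a \<Rightarrow> bool" where
  "spans S a \<longleftrightarrow> rk (insert a S) = rk S"

lemma not_spans_iff: "\<not> spans S a \<longleftrightarrow> rk S < rk (insert a S)"
  using rk_mono[OF subset_insertI[of S a]] by (auto simp: spans_def)

text \<open>Extend a maximum independent \<open>I\<close> in \<open>S\<close> to a maximum
  independent \<open>J\<close> in \<open>T\<close>. If \<open>a\<close> raised the rank of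
  \<open>T\<close>, it could be added to \<open>J\<close>, hence to \<open>I\<close>, and would
  raise the rank of \<open>S\<close> too.\<close>

lemma spans_mono:
  assumes "S \<subseteq> T" "spans S a"
  shows "spans T a"
proof (rule ccontr)
  assume "\<not> spans T a"
  obtain I where I: "I \<subseteq> S" "indep I" "card I = rk S" by (rule rk_attained)
  obtain J where J: "I \<subseteq> J" "J \<subseteq> T" "indep J" "card J = rk T"
    using indep_extend[of I T] I assms by blast
  obtain K where K: "K \<subseteq> insert a T" "indep K" "card K = rk (insert a T)" by (rule rk_attained)
  obtain b where b: "b \<in> K - J" "indep (insert b J)"
    using indep_augment[of J K] J K \<open>\<not> spans T a\<close> by (auto simp: not_spans_iff)
  \<comment> \<open>Any other \<open>b\<close> would lie in \<open>T\<close> and make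
    \<open>insert b J\<close> an independent subset of \<open>T\<close> larger than its
    rank.\<close>
  have "b = a"
  proof (rule ccontr)
    assume "b \<noteq> a"
    then have "card (insert b J) \<le> rk T" using b K J by (intro rk_ge) auto
    then show False using b J finite_indep[of J] by auto
  qed
  then have "indep (insert a I)" using b J indep_subset[of "insert b J"] by blast
  then have "card (insert a I) \<le> rk (insert a S)" using I by (intro rk_ge) auto
  moreover have "a \<notin> I" using b J \<open>b = a\<close> by auto
  ultimately show False using I finite_indep[of I] assms(2) by (auto simp: spans_def)
qed

lemma spans_insert_spanned: "spans S e \<Longrightarrow> spans (insert e S) a \<longleftrightarrow> spans S a"
  using spans_mono[of S "insert e S" a] rk_mono[of "insert a S" "insert a (insert e S)"]
    rk_mono[of S "insert a S"]
  by (fastforce simp: spans_def)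

text \<open>The Mac Lane-Steinitz exchange property: adding both elements raises the rank of
  \<open>S\<close> by at most one, and \<open>a\<close> alone already raises it.\<close>

lemma spans_exchange:
  assumes "spans (insert e S) a" "\<not> spans S a"
  shows "spans (insert a S) e"
proof -
  have "rk (insert a S) \<le> rk (insert e (insert a S))" by (intro rk_mono) auto
  then show ?thesis
    using assms rk_insert_le[of e S] unfolding not_spans_iff
    by (simp add: spans_def insert_commute[of a e])
qed

text \<open>Both conditions say that \<open>{e}\<close> is dependent, since every independent
  singleton extends to a basis.\<close>

lemma loop_iff_spans: "loop e \<longleftrightarrow> e \<in> E \<and> spans {} e"
proof -
  have rk0: "rk {} = 0" by (rule rk_attained[of "{}"]) simp
  have "spans {} e \<longleftrightarrow> \<not> indep {e}"
  proof
    assume "spans {} e"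
    then show "\<not> indep {e}" using rk_ge[of "{e}" "{e}"] rk0 by (auto simp: spans_def)
  next
    assume *: "\<not> indep {e}"
    obtain I where I: "I \<subseteq> {e}" "indep I" "card I = rk {e}" by (rule rk_attained)
    with * have "I = {}" by (auto simp: subset_singleton_iff)
    with I rk0 show "spans {} e" by (simp add: spans_def)
  qed
  moreover have "indep {e} \<longleftrightarrow> (\<exists>B. basis B \<and> e \<in> B)"
  proof
    assume "indep {e}"
    then obtain J where J: "{e} \<subseteq> J" "indep J" "card J = rk E"
      using indep_extend[OF indep_subset_ground] by metis
    have "I = J" if "indep I" "J \<subseteq> I" for I
      using card_seteq[OF finite_indep[OF that(1)] that(2)] rk_ge[of I E]
        indep_subset_ground[OF that(1)] that(1) J(3) by simp
    then show "\<exists>B. basis B \<and> e \<in> B" using J by (auto simp: basis_def)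
  next
    assume "\<exists>B. basis B \<and> e \<in> B"
    then show "indep {e}" using indep_subset[of _ "{e}"] by (auto simp: basis_def)
  qed
  ultimately show ?thesis by (auto simp: loop_def)
qed

section \<open>The sum over all orderings\<close>

text \<open>The set \<open>S\<close> collects the elements already read. Starting from the empty
  set, the factors other than 1 belong to the non-greedy elements.\<close>

fun span_weight :: "('a \<Rightarrow> 'b::field) \<Rightarrow> 'a set \<Rightarrow> 'a list \<Rightarrow> 'b" where
  "span_weight x S [] = 1"
| "span_weight x S (a # l) = (if spans S a then 1 - x a else 1) * span_weight x (insert a S) l"

lemma span_weight_eq_prod:
  "span_weight x S l
    = (\<Prod>i<length l. if spans (S \<union> set (take i l)) (l ! i) then 1 - x (l ! i) else 1)"
proof (induction l arbitrary: S)
  case (Cons a l)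
  show ?case
    unfolding span_weight.simps Cons.IH length_Cons prod.lessThan_Suc_shift by (simp cong: if_cong)
qed simp

lemma span_weight_insert_spanned:
  "spans S e \<Longrightarrow> span_weight x (insert e S) l = span_weight x S l"
proof (induction l arbitrary: S)
  case (Cons a l)
  have "spans (insert a S) e" using Cons.prems spans_mono[of S "insert a S"] by auto
  then show ?case using Cons by (simp add: spans_insert_spanned insert_commute[of a e])
qed simp

text \<open>An element spanned from the outset is non-greedy in every position and alters the status
  of no other element.\<close>

lemma span_weight_insertions:
  assumes "spans S e" "e \<notin> set l" "l' \<in> insertions e l"
  shows "span_weight x S l' = (1 - x e) * span_weight x S l"
  using assms
proof (induction l arbitrary: S l')
  case Nil
  then show ?case by (simp add: insertions_Nil)
next
  case (Cons z l)
  have z: "spans (insert z S) e" using Cons.prems spans_mono[of S "insert z S"] by auto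
  from Cons.prems consider "l' = e # z # l" | m where "m \<in> insertions e l" "l' = z # m"
    by (auto simp: insertions_Cons)
  then show ?case
  proof cases
    case 1
    then show ?thesis using Cons.prems
      by (simp add: span_weight_insert_spanned spans_insert_spanned z insert_commute[of z e])
  next
    case 2
    then show ?thesis using Cons.IH[OF z _ 2(1)] Cons.prems by simp
  qed
qed

text \<open>The span weight is the same for all insertions, so it factors out and only the chain
  weights remain to be summed.\<close>

lemma sum_insertions_spanned:
  fixes x :: "'a \<Rightarrow> 'b::field"
  assumes "inj x" "\<And>a. x a \<noteq> 0" "distinct (e # l)" "\<And>a. a \<in> set (e # l) \<Longrightarrow> u * x a \<noteq> 1"
    and "spans S e"
  shows "(\<Sum>l'\<in>insertions e l. chain_weight x u l' * span_weight x S l')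
    = (1 - x e) * (chain_weight x u l / (1 - u * x e)) * span_weight x S l"
proof -
  have "(\<Sum>l'\<in>insertions e l. chain_weight x u l' * span_weight x S l')
      = (\<Sum>l'\<in>insertions e l. (1 - x e) * span_weight x S l * chain_weight x u l')"
    by (rule sum.cong) (use assms in \<open>auto simp: span_weight_insertions\<close>)
  also have "\<dots> = (1 - x e) * span_weight x S l * (chain_weight x u l / (1 - u * x e))"
    using sum_chain_weight_insertions[OF assms(1-4)] by (simp flip: sum_distrib_left)
  finally show ?thesis by (simp add: mult_ac)
qed

text \<open>
  If \<open>f\<close> is the element of \<open>l\<close> with which \<open>e\<close> becomes spanned, then
  \<open>span_weight x (insert e S) l\<close> is \<open>1 - x f\<close> times \<open>span_weight x S l\<close>. Stating the
  sum in terms of the former avoids mentioning \<open>f\<close> and covers the case that it does not exist.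
\<close>
lemma sum_insertions_not_spanned:
  fixes x :: "'a \<Rightarrow> 'b::field"
  assumes "inj x" "\<And>a. x a \<noteq> 0" "distinct (e # l)" "\<And>a. a \<in> set (e # l) \<Longrightarrow> u * x a \<noteq> 1"
    and "\<not> spans S e"
  shows "(\<Sum>l'\<in>insertions e l. chain_weight x u l' * span_weight x S l')
    = chain_weight x u l * (span_weight x S l
        + u * x e / (1 - u * x e) * span_weight x (insert e S) l)"
  using assms(3-5)
proof (induction l arbitrary: u S)
  case Nil
  then show ?case by (simp add: insertions_Nil field_simps)
next
  case (Cons z l)
  have zu: "1 / x z * x a \<noteq> 1" if "a \<in> set (e # l)" for a
    using Cons.prems(1) that injD[OF assms(1), of a z] assms(2) by (auto simp: field_simps)
  have dist: "distinct (e # l)" using Cons.prems by simp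
  define p where "p = 1 / (1 - u * x e)"
  define q where "q = 1 / (1 - u * x z)"
  define r where "r = 1 / (1 - x z / x e)"
  define s where "s = 1 / (1 - x e / x z)"
  define k where "k = chain_weight x (1 / x z) l"
  define P where "P = span_weight x (insert z S) l"
  define P' where "P' = span_weight x (insert e (insert z S)) l"
  define c where "c = (if spans S z then 1 - x z else 1)"
  define c' where "c' = (if spans (insert e S) z then 1 - x z else 1)"
  define R where
    "R = (\<Sum>l'\<in>insertions e l. chain_weight x (1 / x z) l' * span_weight x (insert z S) l')"
  \<comment> \<open>Either \<open>e\<close> comes first, which gives the term with \<open>c'\<close>
    and \<open>P'\<close>, or \<open>z\<close> does, which leaves the sum \<open>R\<close> over
    insertions into the tail.\<close>
  have "(\<Sum>l'\<in>insertions e l. chain_weight x u (z # l') * span_weight x S (z # l')) = q * c * R"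
    unfolding R_def c_def q_def sum_distrib_left by (intro sum.cong) auto
  then have sum: "(\<Sum>l'\<in>insertions e (z # l). chain_weight x u l' * span_weight x S l')
      = p * r * k * (c' * P') + q * c * R"
    using Cons.prems by (subst sum_insertions_Cons)
      (auto simp: k_def P'_def c'_def p_def r_def insert_commute[of z e])
  have "x e \<noteq> x z" using Cons.prems(1) injD[OF assms(1), of e z] by auto
  note rs = chain_factor_identities[OF this assms(2) assms(2), folded r_def s_def]
  have pq: "p * (1 - u * x e) = 1" "q * (1 - u * x z) = 1"
    using Cons.prems(2) by (auto simp: p_def q_def)
  have goal: "p * r * k * (c' * P') + q * c * R = q * k * (c * P + u * x e * p * (c' * P'))"
  proof (cases "spans (insert z S) e")
    \<comment> \<open>Here \<open>z\<close> is the element that first makes \<open>e\<close>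
      spanned. By exchange, \<open>z\<close> is greedy if read before \<open>e\<close> and
      non-greedy if read after it.\<close>
    case True
    have "\<not> spans S z" using True spans_insert_spanned[of S z e] Cons.prems(3) by auto
    then have "c = 1" by (simp add: c_def)
    moreover have "c' = 1 - x z"
      using spans_exchange[OF True Cons.prems(3)] by (simp add: c'_def)
    moreover have "P' = P" unfolding P_def P'_def using True by (rule span_weight_insert_spanned)
    moreover have "R = (1 - x e) * (k * s) * P"
      unfolding R_def k_def P_def s_def
      using sum_insertions_spanned[OF assms(1,2) dist zu True] by simp
    \<comment> \<open>For \<open>u = 0\<close>, where \<open>p = q = 1\<close>, this is the identity
      \<open>r * (1 - x z) + s * (1 - x e) = 1\<close>.\<close>
    moreover have "p * r * (1 - x z) + q * (1 - x e) * s = q * (1 + u * x e * p * (1 - x z))"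
      using pq rs(1,2) by algebra
    ultimately show ?thesis by algebra
  next
    case False
    \<comment> \<open>If \<open>e\<close> changed the status of \<open>z\<close>, exchange would
      make \<open>e\<close> spanned by \<open>insert z S\<close>.\<close>
    have c: "c' = c"
      using spans_mono[of S "insert e S" z] spans_exchange[of e S z] False
      by (auto simp: c_def c'_def)
    have R: "R = k * (P - r * P')"
    proof -
      have "R = k * (P + 1 / x z * x e / (1 - 1 / x z * x e) * P')"
        unfolding R_def k_def P_def P'_def by (rule Cons.IH[OF dist zu False])
      moreover have "1 / x z * x e / (1 - 1 / x z * x e) = - r" using rs(4) by (simp add: s_def)
      ultimately show ?thesis by (simp only: mult_minus_left add_uminus_conv_diff)
    qed
    have "(p * r - q * r) * (k * c * P') = q * u * x e * p * (k * c * P')"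
    proof -
      have "p * r - q * r = q * u * x e * p" using pq rs(2) by algebra
      then show ?thesis by simp
    qed
    then show ?thesis unfolding c R by (simp add: algebra_simps)
  qed
  show ?case
    unfolding sum goal by (simp add: k_def P_def P'_def c_def c'_def p_def q_def insert_commute[of z e])
qed

text \<open>Add the elements one at a time. For \<open>u = 0\<close> the correction term in
  \<open>sum_insertions_not_spanned\<close> vanishes, so a non-loop contributes the factor 1 and a
  loop \<open>e\<close> contributes \<open>1 - x e\<close>.\<close>

lemma sum_permutations_weights:
  fixes x :: "'a \<Rightarrow> 'b::field"
  assumes "inj x" "\<And>a. x a \<noteq> 0" "finite A"
  shows "(\<Sum>l\<in>permutations_of_set A. chain_weight x 0 l * span_weight x {} l)
    = (\<Prod>a\<in>{a \<in> A. spans {} a}. 1 - x a)"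
  using assms(3)
proof (induction A rule: finite_induct)
  case (insert e A)
  let ?w = "\<lambda>l. chain_weight x 0 l * span_weight x {} l"
  have "(\<Sum>l'\<in>insertions e l. ?w l') = (if spans {} e then 1 - x e else 1) * ?w l"
    if "l \<in> permutations_of_set A" for l
  proof -
    have "distinct (e # l)" using that insert.hyps by (auto simp: permutations_of_set_def)
    then show ?thesis
      using sum_insertions_spanned[of x e l 0 "{}"] sum_insertions_not_spanned[of x e l 0 "{}"]
        assms(1,2) by auto
  qed
  then have "(\<Sum>l\<in>permutations_of_set (insert e A). ?w l)
      = (if spans {} e then 1 - x e else 1) * (\<Prod>a\<in>{a \<in> A. spans {} a}. 1 - x a)"
    using insert by (simp add: sum_permutations_of_set_insert flip: sum_distrib_left)
  also have "\<dots> = (\<Prod>a\<in>{a \<in> insert e A. spans {} a}. 1 - x a)"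
  proof (cases "spans {} e")
    case True
    then have "{a \<in> insert e A. spans {} a} = insert e {a \<in> A. spans {} a}" by auto
    then show ?thesis using True insert.hyps by simp
  next
    case False
    then have "{a \<in> insert e A. spans {} a} = {a \<in> A. spans {} a}" by auto
    then show ?thesis using False by simp
  qed
  finally show ?case .
qed simp

section \<open>From bijective orderings to lists without repetition\<close>

lemma bij_betw_orderings_permutations:
  "bij_betw (\<lambda>\<sigma>. map \<sigma> [1..<Suc (card E)]) orderings (permutations_of_set E)"
proof (rule bij_betw_imageI)
  let ?n = "card E"
  have set: "set [1..<Suc ?n] = {1..?n}" by auto
  show "inj_on (\<lambda>\<sigma>. map \<sigma> [1..<Suc ?n]) orderings"
  proof (rule inj_onI)
    fix \<sigma> \<tau> assume *: "\<sigma> \<in> orderings" "\<tau> \<in> orderings" "map \<sigma> [1..<Suc ?n] = map \<tau> [1..<Suc ?n]"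
    then have "\<sigma> i = \<tau> i" if "i \<in> {1..?n}" for i using that unfolding map_eq_conv set by blast
    with * show "\<sigma> = \<tau>" unfolding orderings_def by (auto intro: PiE_ext)
  qed
  show "(\<lambda>\<sigma>. map \<sigma> [1..<Suc ?n]) ` orderings = permutations_of_set E"
  proof (intro equalityI subsetI)
    fix l assume "l \<in> (\<lambda>\<sigma>. map \<sigma> [1..<Suc ?n]) ` orderings"
    then obtain \<sigma> where \<sigma>: "l = map \<sigma> [1..<Suc ?n]" "bij_betw \<sigma> {1..?n} E"
      by (auto simp: orderings_def)
    then show "l \<in> permutations_of_set E"
      unfolding permutations_of_set_def mem_Collect_eq \<sigma>(1) distinct_map set_map set
      by (auto simp: bij_betw_def)
  next
    fix l assume "l \<in> permutations_of_set E"
    then have l: "set l = E" "distinct l" "length l = ?n"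
      by (auto simp: permutations_of_set_def distinct_card)
    \<comment> \<open>Positions start at 1 and list indices at 0; \<open>restrict\<close> supplies
      the extensionality required by \<open>orderings\<close>.\<close>
    define \<sigma> where "\<sigma> = restrict (\<lambda>i. l ! (i - 1)) {1..?n}"
    have map: "map \<sigma> [1..<Suc ?n] = l"
      by (rule nth_equalityI) (auto simp: \<sigma>_def l simp del: upt_Suc)
    have "\<sigma> ` {1..?n} = E" using l(1) unfolding set[symmetric] set_map[symmetric] map .
    moreover have "inj_on \<sigma> {1..?n}"
      using l(2) unfolding set[symmetric] by (metis map distinct_map)
    ultimately have "\<sigma> \<in> orderings"
      unfolding orderings_def bij_betw_def by (auto simp: \<sigma>_def)
    with map show "l \<in> (\<lambda>\<sigma>. map \<sigma> [1..<Suc ?n]) ` orderings" by force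
  qed
qed

lemma chain_weight_ordering:
  "chain_weight x 0 (map \<sigma> [1..<Suc (card E)])
    = 1 / (\<Prod>i = 1..card E - 1. 1 - x (\<sigma> (i + 1)) / x (\<sigma> i))"
proof -
  have "(\<Prod>i<card E - 1. 1 - x (map \<sigma> [1..<Suc (card E)] ! Suc i) / x (map \<sigma> [1..<Suc (card E)] ! i))
      = (\<Prod>i = 1..card E - 1. 1 - x (\<sigma> (i + 1)) / x (\<sigma> i))"
    by (rule prod.reindex_bij_witness[of _ "\<lambda>i. i - 1" Suc]) (auto simp del: upt_Suc)
  then show ?thesis by (simp add: chain_weight_0 del: upt_Suc)
qed

lemma span_weight_ordering:
  assumes "\<sigma> \<in> orderings"
  shows "span_weight x {} (map \<sigma> [1..<Suc (card E)]) = (\<Prod>i\<in>E - greedy_basis \<sigma>. 1 - x i)"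
proof -
  let ?n = "card E"
  define l where "l = map \<sigma> [1..<Suc ?n]"
  have \<sigma>: "bij_betw \<sigma> {1..?n} E" using assms by (simp add: orderings_def)
  then have inj: "inj_on \<sigma> {1..?n}" by (simp add: bij_betw_def)
  \<comment> \<open>Injectivity forces the index witnessing membership in
    \<open>greedy_basis\<close> to be \<open>i\<close> itself.\<close>
  have greedy: "\<sigma> i \<in> greedy_basis \<sigma> \<longleftrightarrow> \<not> spans (\<sigma> ` {1..i - 1}) (\<sigma> i)" if "i \<in> {1..?n}" for i
  proof -
    have "{1..i} = insert i {1..i - 1}" using that by auto
    then have "\<not> spans (\<sigma> ` {1..i - 1}) (\<sigma> i) \<longleftrightarrow> rk (\<sigma> ` {1..i}) > rk (\<sigma> ` {1..i - 1})"
      by (simp add: not_spans_iff)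
    then show ?thesis
      unfolding greedy_basis_def using that inj by (auto dest: inj_onD)
  qed
  have l: "length l = ?n" "\<And>i. i < ?n \<Longrightarrow> l ! i = \<sigma> (Suc i)"
    "\<And>i. i < ?n \<Longrightarrow> set (take i l) = \<sigma> ` {1..i}"
    by (auto simp: l_def take_map simp del: upt_Suc)
  have "span_weight x {} l
      = (\<Prod>i<?n. if spans (\<sigma> ` {1..i}) (\<sigma> (Suc i)) then 1 - x (\<sigma> (Suc i)) else 1)"
    by (simp add: span_weight_eq_prod l cong: if_cong)
  also have "\<dots> = (\<Prod>i = 1..?n. if spans (\<sigma> ` {1..i - 1}) (\<sigma> i) then 1 - x (\<sigma> i) else 1)"
    by (rule prod.reindex_bij_witness[of _ "\<lambda>i. i - 1" Suc]) auto
  also have "\<dots> = (\<Prod>i = 1..?n. if \<sigma> i \<in> greedy_basis \<sigma> then 1 else 1 - x (\<sigma> i))"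
    by (intro prod.cong) (auto simp: greedy)
  also have "\<dots> = (\<Prod>a\<in>E. if a \<in> greedy_basis \<sigma> then 1 else 1 - x a)"
    by (rule prod.reindex_bij_betw[OF \<sigma>])
  also have "\<dots> = (\<Prod>a\<in>E - greedy_basis \<sigma>. 1 - x a)"
    by (rule prod.mono_neutral_cong_right) (use finite_ground in auto)
  finally show ?thesis unfolding l_def .
qed

end

section \<open>Specialization to the variables of the rational function field\<close>

lemma X_eq_iff: "X a = X b \<longleftrightarrow> a = b"
proof -
  have "a = b" if "laurent_var a = laurent_var b"
    using that by transfer (metis lookup_single_eq lookup_single_not_eq zero_neq_one)
  then show ?thesis by (auto simp: X_def of_laurent_def eq_fract)
qed

lemma X_nonzero: "X a \<noteq> 0"
proof -
  have "laurent_var a \<noteq> 0" by transfer (metis lookup_single_eq lookup_zero zero_neq_one)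
  then show ?thesis by (simp add: X_def of_laurent_def Zero_fract_def eq_fract)
qed

theorem corollary3p4:
  fixes E :: "'a set" and indep :: "'a set \<Rightarrow> bool"
  assumes "matroid E indep" and "E \<noteq> {}"
  shows "matroid.Q E indep (\<lambda>\<sigma>. 1) = (\<Prod>i\<in>{i \<in> E. matroid.loop E indep i}. 1 - X i)"
proof -
  interpret matroid E indep by fact
  have "Q (\<lambda>\<sigma>. 1) = (\<Sum>\<sigma>\<in>orderings. chain_weight X 0 (map \<sigma> [1..<Suc (card E)])
      * span_weight X {} (map \<sigma> [1..<Suc (card E)]))"
    unfolding Q_def
    by (intro sum.cong refl)
      (simp add: chain_weight_ordering span_weight_ordering of_laurent_def flip: One_fract_def
        del: upt_Suc One_nat_def)
  also have "\<dots> = (\<Sum>l\<in>permutations_of_set E. chain_weight X 0 l * span_weight X {} l)"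
    by (rule sum.reindex_bij_betw[OF bij_betw_orderings_permutations])
  \<comment> \<open>The variables are distinct and nonzero, so no denominator
    \<open>1 - X b / X a\<close> with \<open>a\<close> and \<open>b\<close> distinct
    vanishes.\<close>
  also have "\<dots> = (\<Prod>a\<in>{a \<in> E. spans {} a}. 1 - X a)"
    by (rule sum_permutations_weights)
      (auto simp: inj_def X_eq_iff X_nonzero finite_ground)
  also have "{a \<in> E. spans {} a} = {i \<in> E. loop i}" by (auto simp: loop_iff_spans)
  finally show ?thesis .
qed

end
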